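(* Let $m\ge1$ and $n\ge 1$. There is an eigenspace decomposition of $V^{\otimes n}$ with respect to $\sigma_n$: $$V^{\otimes n}=\ker\sigma_n\oplus(V\otimes\ker\sigma_{n-1})\oplus([V]_2\otimes\ker\sigma_{n-2})\oplus\cdots\oplus[V]_n,$$ where $\ker\sigma_n$ is the eigenspace of $\sigma_n$ for the eigenvalue $0$, and, for $1\le k\le n$, $[V]_k\otimes\ker\sigma_{n-k}$ is the eigenspace of $\sigma_n$ for the eigenvalue $[k]_{y^2}=1+y^2+\cdots+y^{2k-2}$ (here the eigenspace for $\lambda$ means $\{x\in V^{\otimes n}:\sigma_n(x)=\lambda x\}$, which may be zero).
   Context: Let $\mathbb{K}=\mathbb{C}(y)$, and let $V=V_m$ be the $\mathbb{K}$-vector space with basis $v_1,\dots,v_m$; tensor products are over $\mathbb{K}$. The Yang-Baxter operator $R=R_m:V\otimes V\to V\otimes V$ is the linear map with $R(v_i\otimes v_j)=(1-y^2)v_i\otimes v_j+y^2v_j\otimes v_i$ and $R(v_j\otimes v_i)=v_i\otimes v_j$ for $1\le i<j\le m$, and $R(v_i\otimes v_i)=v_i\otimes v_i$. For $n\ge1$ let $d_1^n=\mathrm{id}_{V^{\otimes n}}$ and, for $2\le k\le n$, $d_k^n=(R\otimes\mathrm{id}_{V^{\otimes n-2}})\circ(\mathrm{id}_V\otimes R\otimes\mathrm{id}_{V^{\otimes n-3}})\circ\cdots\circ(\mathrm{id}_{V^{\otimes k-2}}\otimes R\otimes\mathrm{id}_{V^{\otimes n-k}})$ (the rightmost map is applied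 first). Let $\sigma_n=\sum_{k=1}^n(-1)^{k-1}d_k^n:V^{\otimes n}\to V^{\otimes n}$, and put $\ker\sigma_0=\mathbb{K}=V^{\otimes0}$. For $n\ge 1$, $[V]_n\subset V^{\otimes n}$ is the span of all elements $[v_{i_1},\dots,v_{i_n}]=\sum_{\tau\in S_n}\mathrm{sgn}(\tau)\,v_{i_{\tau(1)}}\otimes\cdots\otimes v_{i_{\tau(n)}}$, with $\mathrm{sgn}(\tau)\in\{1,-1\}$ the sign of $\tau$; so $[V]_1=V$ and $[V]_n=0$ for $n>m$. *)

theory Defs
  imports
    "HOL-Library.Poly_Mapping"
    "HOL-Library.FuncSet"
    "HOL-Combinatorics.Permutations"
    "HOL-Computational_Algebra.Polynomial"
    "HOL-Computational_Algebra.Fraction_Field"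
begin

type_synonym ratfun = "complex poly fract"

definition yK :: ratfun where
  "yK = Fract [:0, 1:] 1"

text \<open>
  The word \<open>[i\<^sub>1, \<dots>, i\<^sub>n]\<close> stands for the basis tensor
  \<open>v\<^sub>i\<^sub>1 \<otimes> \<dots> \<otimes> v\<^sub>i\<^sub>n\<close>.  Finitely supported functions on words
  form the free vector space on all words, which contains every tensor power of
  every \<open>V\<^sub>m\<close> as the span of the words of length \<open>n\<close> with letters in
  \<open>{1..m}\<close>; the empty word spans the ground field, the tensor power of degree 0.
\<close>

type_synonym tens = "nat list \<Rightarrow>\<^sub>0 ratfun"

definition scaleT :: "ratfun \<Rightarrow> tens \<Rightarrow> tens" where
  "scaleT c x = Poly_Mapping.map (\<lambda>a. c * a) x"

lemma lookup_scaleT: "Poly_Mapping.lookup (scaleT c x) w = c * Poly_Mapping.lookup x w"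
  by (simp add: scaleT_def map.rep_eq when_def)

global_interpretation tens: vector_space scaleT
  by unfold_locales
    (auto intro!: poly_mapping_eqI simp: lookup_scaleT lookup_add algebra_simps)

definition basisT :: "nat list \<Rightarrow> tens" where
  "basisT w = Poly_Mapping.single w 1"

definition words :: "nat \<Rightarrow> nat \<Rightarrow> nat list set" where
  "words m n = {w. length w = n \<and> set w \<subseteq> {1..m}}"

definition tpow :: "nat \<Rightarrow> nat \<Rightarrow> tens set" where
  "tpow m n = tens.span (basisT ` words m n)"

text \<open>The linear map that sends each basis word \<open>w\<close> to \<open>f w\<close>.\<close>

definition lin_ext :: "(nat list \<Rightarrow> tens) \<Rightarrow> tens \<Rightarrow> tens" where
  "lin_ext f x = (\<Sum>w\<in>Poly_Mapping.keys x. scaleT (Poly_Mapping.lookup x w) (f w))"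

definition tensor :: "tens \<Rightarrow> tens \<Rightarrow> tens" (infixr "\<otimes>\<^sub>T" 70) where
  "x \<otimes>\<^sub>T y = lin_ext (\<lambda>u. lin_ext (\<lambda>v. basisT (u @ v)) y) x"

definition tensor_space :: "tens set \<Rightarrow> tens set \<Rightarrow> tens set" where
  "tensor_space A B = tens.span {a \<otimes>\<^sub>T b |a b. a \<in> A \<and> b \<in> B}"

text \<open>
  The tensor product of linear maps \<open>f\<close> and \<open>g\<close>, where \<open>f\<close> acts on the first
  \<open>k\<close> tensor factors and \<open>g\<close> on the remaining ones.
\<close>

definition tensor_map :: "nat \<Rightarrow> (tens \<Rightarrow> tens) \<Rightarrow> (tens \<Rightarrow> tens) \<Rightarrow> tens \<Rightarrow> tens" where
  "tensor_map k f g =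
     lin_ext (\<lambda>w. f (basisT (take k w)) \<otimes>\<^sub>T g (basisT (drop k w)))"

text \<open>
  The formula does not mention \<open>m\<close>: the operator \<open>R\<^sub>m\<close> is the restriction to
  \<open>tpow m 2\<close>.  Values on words of length other than 2 are irrelevant.
\<close>

definition YB :: "tens \<Rightarrow> tens" where
  "YB = lin_ext (\<lambda>w. let i = w ! 0; j = w ! 1 in
     if i < j then scaleT (1 - yK\<^sup>2) (basisT [i, j]) + scaleT (yK\<^sup>2) (basisT [j, i])
     else if j < i then basisT [j, i]
     else basisT [i, i])"

text \<open>\<open>id \<otimes> R \<otimes> id\<close> with \<open>a\<close> tensor factors to the left of \<open>R\<close>.\<close>

definition YB_at :: "nat \<Rightarrow> tens \<Rightarrow> tens" where
  "YB_at a = tensor_map a id (tensor_map 2 YB id)"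

text \<open>
  \<open>dmap k = YB_at 0 \<circ> YB_at 1 \<circ> \<dots> \<circ> YB_at (k - 2)\<close>; on \<open>tpow m n\<close> with
  \<open>1 \<le> k \<le> n\<close> this is \<open>d\<^sub>k\<close> in degree \<open>n\<close>.
\<close>

definition dmap :: "nat \<Rightarrow> tens \<Rightarrow> tens" where
  "dmap k = foldr (\<circ>) (map YB_at [0..<k - 1]) id"

definition sigma :: "nat \<Rightarrow> tens \<Rightarrow> tens" where
  "sigma n x = (\<Sum>k = 1..n. scaleT ((-1) ^ (k - 1)) (dmap k x))"

definition ker_sigma :: "nat \<Rightarrow> nat \<Rightarrow> tens set" where
  "ker_sigma m n = (if n = 0 then tpow m 0 else {x \<in> tpow m n. sigma n x = 0})"

definition eigenspace :: "nat \<Rightarrow> nat \<Rightarrow> ratfun \<Rightarrow> tens set" where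
  "eigenspace m n c = {x \<in> tpow m n. sigma n x = scaleT c x}"

definition bracket :: "nat list \<Rightarrow> tens" where
  "bracket w = (\<Sum>\<tau> | \<tau> permutes {..<length w}.
     scaleT (of_int (sign \<tau>)) (basisT (permute_list \<tau> w)))"

definition bracket_space :: "nat \<Rightarrow> nat \<Rightarrow> tens set" where
  "bracket_space m n = tens.span (bracket ` words m n)"

definition q_int :: "nat \<Rightarrow> ratfun" where
  "q_int k = (\<Sum>i<k. yK ^ (2 * i))"

text \<open>\<open>W\<close> is the internal direct sum of the subspaces \<open>E k\<close> for \<open>k \<in> I\<close>.\<close>

definition is_direct_sum :: "tens set \<Rightarrow> nat set \<Rightarrow> (nat \<Rightarrow> tens set) \<Rightarrow> bool" where
  "is_direct_sum W I E \<longleftrightarrow>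
     tens.subspace W \<and> (\<forall>k\<in>I. tens.subspace (E k) \<and> E k \<subseteq> W) \<and>
     (\<forall>x\<in>W. \<exists>!f. f \<in> (\<Pi>\<^sub>E k\<in>I. E k) \<and> x = (\<Sum>k\<in>I. f k))"

end

theory Submission imports Defs begin

text \<open>
  Put \<open>q = y\<^sup>2\<close> and let \<open>T\<^sub>a\<close> be \<open>-R\<close> acting on the tensor factors \<open>a, a + 1\<close> (counted from 0).  The
  \<open>T\<^sub>a\<close> satisfy the relations of the Hecke algebra, with \<open>(T\<^sub>a - q)(T\<^sub>a + 1) = 0\<close>, and \<open>\<sigma>\<^sub>n\<close> is
  \<open>s\<^sub>0 = 1 + T\<^sub>0 + T\<^sub>0T\<^sub>1 + \<dots> + T\<^sub>0\<cdots>T\<^bsub>n-2\<^esub>\<close>.  Let \<open>s\<^sub>j\<close> be the same operator on the last \<open>n - j\<close> factors,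
  so \<open>s\<^sub>j = 1 + T\<^sub>j s\<^bsub>j+1\<^esub>\<close>.  Call \<open>x\<close> \<open>k\<close>-alternating if \<open>T\<^sub>a x = q x\<close> for all \<open>a < k - 1\<close>.  On such \<open>x\<close>,
  \<open>s\<^sub>0 x = [k] x + T\<^sub>0\<cdots>T\<^bsub>k-1\<^esub> s\<^sub>k x\<close>.

  The image of \<open>A\<^sub>k = s\<^sub>0 (s\<^sub>0 - [1]) \<cdots> (s\<^sub>0 - [k-1])\<close> is \<open>k\<close>-alternating: \<open>T\<^sub>a\<close> with \<open>a > 0\<close> moves through
  \<open>T\<^sub>0\<cdots>T\<^bsub>k-1\<^esub>\<close> by the braid relations, turning into \<open>T\<^bsub>a-1\<^esub>\<close>, and for \<open>a = 0\<close> it suffices that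
  \<open>(T\<^sub>0 - q) s\<^sub>0 (s\<^sub>0 - 1) = 0\<close>, which follows by descending induction on the index of \<open>s\<^sub>j\<close>.  Hence
  \<open>A\<^bsub>n+1\<^esub> = 0\<close>, so \<open>\<sigma>\<^sub>n\<close> is diagonalizable with eigenvalues among the distinct \<open>[0], \<dots>, [n]\<close>.  An
  eigenvector \<open>x\<close> for \<open>[k]\<close> is a multiple of \<open>A\<^sub>k x\<close>, hence \<open>k\<close>-alternating, and then \<open>s\<^sub>k x = 0\<close> because the
  \<open>T\<^sub>a\<close> are injective.  Being \<open>k\<close>-alternating means antisymmetry in the first \<open>k\<close> factors, whatever
  \<open>q\<close> is, so \<open>x\<close> is \<open>1/k!\<close> times its antisymmetrization, which lies in \<open>[V]\<^sub>k \<otimes> ker \<sigma>\<^bsub>n-k\<^esub>\<close>.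
\<close>

section \<open>Hecke algebra actions\<close>

text \<open>The relations are assumed only on the invariant subspace \<open>X\<close>, later
  \<open>tpow m n\<close>, because the operators of the application are defined on tensors of all
  degrees, including words too short for position \<open>a\<close>.\<close>

locale hecke_action = vector_space scale
  for scale :: "'k::field \<Rightarrow> 'v::ab_group_add \<Rightarrow> 'v" (infixr "\<cdot>" 75) +
  fixes X :: "'v set" and T :: "nat \<Rightarrow> 'v \<Rightarrow> 'v" and q :: 'k and n :: nat
  assumes X: "subspace X"
    and lin_T: "Vector_Spaces.linear scale scale (T a)"
    and T_closed: "\<lbrakk>x \<in> X; Suc a < n\<rbrakk> \<Longrightarrow> T a x \<in> X"
    and quadratic: "\<lbrakk>x \<in> X; Suc a < n\<rbrakk> \<Longrightarrow> T a (T a x) = (q - 1) \<cdot> T a x + q \<cdot> x"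
    and commute: "\<lbrakk>x \<in> X; Suc a < b; Suc b < n\<rbrakk> \<Longrightarrow> T a (T b x) = T b (T a x)"
    and braid: "\<lbrakk>x \<in> X; Suc (Suc a) < n\<rbrakk> \<Longrightarrow>
      T a (T (Suc a) (T a x)) = T (Suc a) (T a (T (Suc a) x))"
    and q_nonzero: "q \<noteq> 0"
begin

sublocale self: module_pair scale scale
  by unfold_locales

lemma hom_T: "module_hom scale scale (T a)"
  using lin_T by (simp add: linear_iff_module_hom)

lemmas T_add = module_hom.add[OF hom_T]
  and T_scale = module_hom.scale[OF hom_T]
  and T_zero = module_hom.zero[OF hom_T]
  and T_diff = module_hom.diff[OF hom_T]
  and T_sum = module_hom.sum[OF hom_T]

lemma T_inj:
  assumes "x \<in> X" "Suc a < n" "T a x = 0"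
  shows "x = 0"
proof -
  have "q \<cdot> x = 0"
    using quadratic[OF assms(1,2)] assms(3) by (simp add: T_zero)
  then show ?thesis using q_nonzero by simp
qed

section \<open>Products of consecutive generators and their sums\<close>

primrec path :: "nat \<Rightarrow> nat \<Rightarrow> 'v \<Rightarrow> 'v" where
  "path j 0 x = x"
| "path j (Suc k) x = T j (path (Suc j) k x)"

text \<open>For \<open>j \<ge> n\<close> the sum is empty and \<open>s j\<close> is zero. The
  recursion and the splitting below thus reach the last index, where a \<open>T\<close> outside the
  allowed range is applied only to zero.\<close>

definition s :: "nat \<Rightarrow> 'v \<Rightarrow> 'v" where
  "s j x = (\<Sum>k<n - j. path j k x)"

lemma path_closed: "\<lbrakk>x \<in> X; j + k < n\<rbrakk> \<Longrightarrow> path j k x \<in> X"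
proof (induction k arbitrary: j)
  case (Suc k)
  then show ?case using T_closed[of "path (Suc j) k x" j] by simp
qed simp

lemma hom_path: "module_hom scale scale (path j k)"
proof (induction k arbitrary: j)
  case 0
  show ?case by (simp add: module_hom_iff module_axioms)
next
  case (Suc k)
  have "path j (Suc k) = T j \<circ> path (Suc j) k"
    by (simp add: fun_eq_iff)
  then show ?case by (simp only: module_hom_compose[OF Suc hom_T])
qed

lemmas path_sum = module_hom.sum[OF hom_path]

lemma path_inj:
  "\<lbrakk>x \<in> X; j + k < n; path j k x = 0\<rbrakk> \<Longrightarrow> x = 0"
proof (induction k arbitrary: j)
  case (Suc k)
  then have "path (Suc j) k x = 0"
    using T_inj[of "path (Suc j) k x" j] path_closed[of x "Suc j" k] by simp
  then show ?case using Suc.IH[of "Suc j"] Suc.prems by simp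
qed simp

lemma path_append: "path j (k + l) x = path j k (path (j + k) l x)"
  by (induction k arbitrary: j) auto

lemma hom_s: "module_hom scale scale (s j)"
proof -
  have "module_hom scale scale (\<lambda>x. \<Sum>k<n - j. path j k x)"
    by (intro self.module_hom_sum) (auto intro: hom_path module_axioms)
  then show ?thesis by (simp add: s_def[abs_def])
qed

lemmas s_add = module_hom.add[OF hom_s]
  and s_scale = module_hom.scale[OF hom_s]
  and s_diff = module_hom.diff[OF hom_s]

lemma s_rec: "j < n \<Longrightarrow> s j x = x + T j (s (Suc j) x)"
proof -
  assume "j < n"
  then have "n - j = Suc (n - Suc j)" by simp
  then show ?thesis by (simp add: s_def sum.lessThan_Suc_shift T_sum del: sum.lessThan_Suc)
qed

lemma s_end: "n \<le> j \<Longrightarrow> s j x = 0"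
  by (simp add: s_def)

lemma s_split:
  assumes "k \<le> n"
  shows "s 0 x = (\<Sum>i<k. path 0 i x) + path 0 k (s k x)"
proof -
  have "s 0 x = (\<Sum>i<k + (n - k). path 0 i x)"
    using assms by (simp add: s_def)
  also have "\<dots> = (\<Sum>i<k. path 0 i x) + (\<Sum>i<n - k. path 0 (k + i) x)"
    using sum.atLeastLessThan_concat[of 0 k "k + (n - k)" "\<lambda>i. path 0 i x"]
      sum.shift_bounds_nat_ivl[of "\<lambda>i. path 0 i x" 0 k "n - k"]
    by (simp add: atLeast0LessThan add.commute)
  finally show ?thesis
    by (simp add: path_append path_sum s_def)
qed

lemma s_closed: "x \<in> X \<Longrightarrow> s j x \<in> X"
  unfolding s_def by (intro subspace_sum[OF X] path_closed) auto

lemma path_commute: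
  "\<lbrakk>x \<in> X; Suc b < j; j + k < n\<rbrakk> \<Longrightarrow> T b (path j k x) = path j k (T b x)"
proof (induction k arbitrary: j)
  case (Suc k)
  then show ?case
    using commute[of "path (Suc j) k x" b j] path_closed[of x "Suc j" k] by simp
qed simp

lemma s_commute:
  assumes "x \<in> X" "Suc b < j"
  shows "T b (s j x) = s j (T b x)"
  unfolding s_def T_sum by (intro sum.cong refl path_commute) (use assms in auto)

text \<open>\<open>T (Suc b)\<close> commutes past the factors before \<open>T b\<close>, turns into
  \<open>T b\<close> by the braid relation with \<open>T b\<close> and \<open>T (Suc b)\<close>, and
  commutes past the remaining factors.\<close>

lemma path_shift:
  "\<lbrakk>x \<in> X; j \<le> b; Suc b < j + k; j + k < n\<rbrakk> \<Longrightarrow>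
    T (Suc b) (path j k x) = path j k (T b x)"
proof (induction k arbitrary: j)
  case (Suc k)
  show ?case
  proof (cases "b = j")
    case True
    with Suc.prems obtain l where k: "k = Suc l" by (cases k) auto
    let ?y = "path (Suc (Suc j)) l x"
    have y: "?y \<in> X" using Suc.prems k by (intro path_closed) auto
    have "T (Suc b) (path j (Suc k) x) = T j (T (Suc j) (T j ?y))"
      using Suc.prems k True braid[OF y, of j] by simp
    also have "T j ?y = path (Suc (Suc j)) l (T j x)"
      using Suc.prems k by (intro path_commute) auto
    finally show ?thesis using k True by simp
  next
    case False
    then have "j < b" using Suc.prems by simp
    then show ?thesis
      using Suc commute[of "path (Suc j) k x" j "Suc b"] path_closed[of x "Suc j" k] by simp
  qed
qed simp

text \<open>Expanding with \<open>u = s (Suc j) x\<close> and \<open>z = s (Suc (Suc j)) u\<close>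
  leaves two terms. The first lies in the image of \<open>T j + 1\<close>, which
  \<open>T j - q\<close> kills; the second is treated by the induction hypothesis for
  \<open>Suc j\<close>.\<close>

lemma s_quadratic:
  "\<lbrakk>x \<in> X; Suc j < n\<rbrakk> \<Longrightarrow> T j (s j (s j x) - s j x) = q \<cdot> (s j (s j x) - s j x)"
proof (induction "n - j" arbitrary: j)
  case 0
  then show ?case by simp
next
  case (Suc d)
  define u where "u = s (Suc j) x"
  define z where "z = s (Suc (Suc j)) u"
  have uX: "u \<in> X" and zX: "z \<in> X"
    by (simp_all add: u_def z_def s_closed Suc.prems)
  have Tu: "T j u \<in> X" using T_closed uX Suc.prems by auto
  have sj: "s j y = y + T j (s (Suc j) y)" for y
    using Suc.prems by (intro s_rec) simp
  have sj': "s (Suc j) y = y + T (Suc j) (s (Suc (Suc j)) y)" for y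
    using Suc.prems by (intro s_rec) simp
  have "s j (s j x) - s j x = T j (s (Suc j) (s j x))"
    by (simp add: sj[of "s j x"])
  also have "s (Suc j) (s j x) = u + s (Suc j) (T j u)"
    by (simp add: sj[of x] s_add u_def)
  also have "s (Suc j) (T j u) = T j u + T (Suc j) (T j z)"
    using s_commute[OF uX, of j "Suc (Suc j)"] by (simp add: sj' z_def)
  finally have A: "s j (s j x) - s j x = q \<cdot> (T j u + u) + T j (T (Suc j) (T j z))"
    using quadratic[OF uX, of j] Suc.prems by (simp add: T_add algebra_simps)
  have 1: "T j (T j u + u) = q \<cdot> (T j u + u)"
    using quadratic[OF uX, of j] Suc.prems by (simp add: T_add algebra_simps)
  have 2: "T j (T j (T (Suc j) (T j z))) = q \<cdot> T j (T (Suc j) (T j z))"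
  proof (cases "Suc (Suc j) < n")
    case True
    have "s (Suc j) u - u = T (Suc j) z" by (simp add: sj' z_def)
    then have IH: "T (Suc j) (T (Suc j) z) = q \<cdot> T (Suc j) z"
      using Suc.hyps(1)[of "Suc j"] Suc.hyps(2) Suc.prems True unfolding u_def by simp
    \<comment> \<open>The induction hypothesis is this equation with \<open>T (Suc j)\<close>
      applied to it, and that operator is injective.\<close>
    have "T (Suc j) z - q \<cdot> z = 0"
    proof (rule T_inj[of _ "Suc j"])
      show "T (Suc j) z - q \<cdot> z \<in> X"
        using zX True by (intro subspace_diff subspace_scale X T_closed)
    qed (use True IH in \<open>auto simp: T_diff T_scale\<close>)
    then have z: "T (Suc j) z = q \<cdot> z" by simp
    \<comment> \<open>The braid relation carries the outer \<open>T j\<close> through to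
      \<open>z\<close> as \<open>T (Suc j)\<close>, which acts there as \<open>q\<close>.\<close>
    have "T j (T j (T (Suc j) (T j z))) = T j (T (Suc j) (T j (T (Suc j) z)))"
      using braid[OF zX True] braid[OF T_closed[OF zX, of j], of j] True 
      by simp
    then show ?thesis by (simp add: z T_scale)
  next
    case False
    then show ?thesis by (simp add: z_def s_end T_zero)
  qed
  show ?case unfolding A T_add[of j "q \<cdot> (T j u + u)"] T_scale 1 2 by (simp only: scale_right_distrib)
qed

section \<open>Alternating vectors and the products \<open>A k\<close>\<close>

definition qn :: "nat \<Rightarrow> 'k" where
  "qn k = (\<Sum>i<k. q ^ i)"

primrec A :: "nat \<Rightarrow> 'v \<Rightarrow> 'v" where
  "A 0 x = x"
| "A (Suc k) x = s 0 (A k x) - qn k \<cdot> A k x"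

lemma A_closed: "x \<in> X \<Longrightarrow> A k x \<in> X"
  by (induction k) (auto intro!: subspace_diff subspace_scale X s_closed)

definition W :: "nat \<Rightarrow> 'v set" where
  "W k = {x \<in> X. \<forall>a. Suc a < k \<longrightarrow> T a x = q \<cdot> x}"

lemma path_W: "\<lbrakk>x \<in> W k; j + i < k\<rbrakk> \<Longrightarrow> path j i x = q ^ i \<cdot> x"
proof (induction i arbitrary: j)
  case (Suc i)
  then show ?case by (simp add: T_scale W_def mult.commute)
qed simp

text \<open>On \<open>W k\<close> the first \<open>k\<close> summands of \<open>s 0\<close> act as
  \<open>1, q, ..., q ^ (k - 1)\<close>.\<close>

lemma s_W:
  assumes "x \<in> W k" "k \<le> n"
  shows "s 0 x = qn k \<cdot> x + path 0 k (s k x)"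
  using s_split[OF assms(2), of x] path_W[OF assms(1), of 0]
  by (simp add: qn_def scale_sum_left)

text \<open>The factors of \<open>A k\<close> commute, so \<open>s 0 \<circ> (s 0 - 1)\<close> can be moved to the left.\<close>

lemma T0_A:
  assumes "x \<in> X" "2 \<le> k" "2 \<le> n"
  shows "T 0 (A k x) = q \<cdot> A k x"
proof -
  have "\<exists>y\<in>X. A k x = s 0 (s 0 y) - s 0 y"
    using assms(2)
  proof (induction k rule: nat_induct_at_least)
    case base
    show ?case using assms(1)
      by (intro bexI[of _ x]) (auto simp: numeral_2_eq_2 qn_def)
  next
    case (Suc k)
    then obtain y where y: "y \<in> X" "A k x = s 0 (s 0 y) - s 0 y" by blast
    show ?case
    proof (intro bexI)
      show "s 0 y - qn k \<cdot> y \<in> X"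
        using y by (intro subspace_diff subspace_scale X s_closed)
    qed (simp add: y s_diff s_scale algebra_simps)
  qed
  then show ?thesis using s_quadratic[of _ 0] assms(3) by auto
qed

lemma A_W: "\<lbrakk>x \<in> X; k \<le> n\<rbrakk> \<Longrightarrow> A k x \<in> W k"
proof (induction k)
  case 0
  then show ?case by (simp add: W_def)
next
  case (Suc k)
  then have W: "A k x \<in> W k" and sX: "s k (A k x) \<in> X"
    by (auto intro: s_closed A_closed)
  have AS: "A (Suc k) x = path 0 k (s k (A k x))"
    using s_W[OF W] Suc.prems by simp
  have "T a (A (Suc k) x) = q \<cdot> A (Suc k) x" if a: "Suc a < Suc k" for a
  proof (cases a)
    case 0
    then show ?thesis using that Suc.prems T0_A[of x "Suc k"] by (simp del: A.simps)
  next
    case (Suc b)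
    have "T a (A (Suc k) x) = path 0 k (T b (s k (A k x)))"
      unfolding AS Suc using a Suc Suc.prems sX by (intro path_shift) auto
    \<comment> \<open>Here \<open>Suc b < k\<close>, so \<open>T b\<close> commutes with
      \<open>s k\<close> and meets a vector of \<open>W k\<close>.\<close>
    also have "T b (s k (A k x)) = s k (q \<cdot> A k x)"
      using s_commute[of "A k x" b k] W a Suc by (auto simp: W_def)
    finally show ?thesis
      by (simp add: AS s_scale module_hom.scale[OF hom_path] del: A.simps)
  qed
  then show ?case using A_closed[OF Suc.prems(1)] by (simp add: W_def del: A.simps)
qed

text \<open>Since \<open>s n\<close> is zero, \<open>s 0\<close> acts on \<open>W n\<close> as the
  scalar \<open>qn n\<close>, so the last factor of \<open>A (Suc n)\<close> kills
  \<open>A n x\<close>.\<close>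

lemma A_vanish: "x \<in> X \<Longrightarrow> A (Suc n) x = 0"
  using s_W[OF A_W[of x n]] by (simp add: s_end module_hom.zero[OF hom_path])

section \<open>Diagonalization of \<open>s 0\<close>\<close>

lemma eigenvector_iff:
  assumes distinct: "\<And>l. l < k \<Longrightarrow> qn l \<noteq> qn k" and k: "k \<le> n" and x: "x \<in> X"
  shows "s 0 x = qn k \<cdot> x \<longleftrightarrow> x \<in> W k \<and> s k x = 0"
proof
  assume eig: "s 0 x = qn k \<cdot> x"
  have "A l x = (\<Prod>i<l. qn k - qn i) \<cdot> x" for l
    by (induction l) (auto simp: s_scale eig algebra_simps)
  then have Ak: "(\<Prod>i<k. qn k - qn i) \<cdot> x \<in> W k"
    using A_W[OF x k] by simp
  have nz: "(\<Prod>i<k. qn k - qn i) \<noteq> 0" using distinct by force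
  have W: "x \<in> W k"
  proof -
    have "T a x = q \<cdot> x" if "Suc a < k" for a
    proof -
      let ?c = "\<Prod>i<k. qn k - qn i"
      have "?c \<cdot> T a x = q \<cdot> (?c \<cdot> x)" using Ak that unfolding W_def by (simp add: T_scale)
      then have "?c \<cdot> T a x = ?c \<cdot> (q \<cdot> x)" by (simp add: mult.commute)
      then show ?thesis using nz by (simp only: scale_cancel_left) simp
    qed
    then show ?thesis using x by (simp add: W_def)
  qed
  have "s k x = 0"
  \<comment> \<open>Comparing with \<open>s_W\<close> gives \<open>path 0 k (s k x) = 0\<close>;
    injectivity of the path requires \<open>k < n\<close>.\<close>
  proof (cases "k = n")
    case False
    then show ?thesis
      using s_W[OF W k] eig path_inj[of "s k x" 0 k] s_closed[OF x] k by simp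
  qed (simp add: s_end)
  with W show "x \<in> W k \<and> s k x = 0" ..
next
  assume "x \<in> W k \<and> s k x = 0"
  then show "s 0 x = qn k \<cdot> x"
    using s_W[of x k] k by (simp add: module_hom.zero[OF hom_path])
qed

text \<open>If \<open>A (Suc N) x = 0\<close>, then \<open>z = A N x\<close> is an eigenvector for
  \<open>qn N\<close>, on which \<open>A N\<close> acts as a nonzero scalar \<open>d\<close>.
  Subtracting \<open>z / d\<close> from \<open>x\<close> leaves a vector killed by
  \<open>A N\<close>, and induction applies.\<close>

lemma eigenvector_decomposition:
  assumes inj: "inj_on qn {..n}" and x: "x \<in> X"
  shows "\<exists>f. (\<forall>k\<le>n. f k \<in> X \<and> s 0 (f k) = qn k \<cdot> f k) \<and> x = (\<Sum>k\<le>n. f k)"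
proof -
  have hom_A: "module_hom scale scale (A k)" for k
  proof (induction k)
    case 0
    show ?case by (simp add: module_hom_iff module_axioms)
  next
    case (Suc k)
    have "module_hom scale scale (\<lambda>x. (s 0 \<circ> A k) x - qn k \<cdot> A k x)"
      using module_hom_compose[OF Suc hom_s] Suc
      by (intro self.module_hom_sub self.module_hom_scale)
    then show ?case by (simp add: comp_def A.simps(2)[abs_def])
  qed
  have "\<exists>f. (\<forall>k<N. f k \<in> X \<and> s 0 (f k) = qn k \<cdot> f k) \<and> x = (\<Sum>k<N. f k)"
    if "N \<le> Suc n" "x \<in> X" "A N x = 0" for N x
    using that
  proof (induction N arbitrary: x)
    case (Suc N)
    define z where "z = A N x"
    define d where "d = (\<Prod>i<N. qn N - qn i)"
    have zX: "z \<in> X" using Suc.prems by (simp add: z_def A_closed)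
    have sz: "s 0 z = qn N \<cdot> z" using Suc.prems by (simp add: z_def)
    have d: "d \<noteq> 0" unfolding d_def using Suc.prems inj_onD[OF inj, of N] by fastforce
    have Az: "A l z = (\<Prod>i<l. qn N - qn i) \<cdot> z" for l
      by (induction l) (auto simp: s_scale sz algebra_simps)
    define w where "w = inverse d \<cdot> z"
    have "A N w = z"
      using d by (simp add: w_def module_hom.scale[OF hom_A] Az flip: d_def)
    then have "A N (x - w) = 0" by (simp add: module_hom.diff[OF hom_A] z_def)
    moreover have wX: "w \<in> X" unfolding w_def using zX by (intro subspace_scale X)
    ultimately obtain f where f: "\<forall>k<N. f k \<in> X \<and> s 0 (f k) = qn k \<cdot> f k" "x - w = (\<Sum>k<N. f k)"
      using Suc.IH[of "x - w"] Suc.prems X by (auto intro: subspace_diff)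
    have "s 0 w = qn N \<cdot> w" by (simp add: w_def s_scale sz mult.commute)
    then show ?case using f wX
      by (intro exI[of _ "f(N := w)"]) (auto simp: less_Suc_eq algebra_simps)
  qed auto
  from this[OF order_refl x A_vanish[OF x]] show ?thesis
    by (simp add: lessThan_Suc_atMost less_Suc_eq_le)
qed

text \<open>Applying \<open>s 0 - qn N\<close> to the sum removes the last term and rescales each of
  the others by a nonzero factor.\<close>

lemma eigenvectors_independent:
  "\<lbrakk>inj_on qn {..<N}; \<forall>k<N. s 0 (f k) = qn k \<cdot> f k; (\<Sum>k<N. f k) = 0; k < N\<rbrakk> \<Longrightarrow> f k = 0"
proof (induction N arbitrary: f k)
  case (Suc N)
  define g where "g k = (qn k - qn N) \<cdot> f k" for k
  have "s 0 (\<Sum>k<Suc N. f k) - qn N \<cdot> (\<Sum>k<Suc N. f k) = 0"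
    using Suc.prems(3) by (simp add: module_hom.zero[OF hom_s])
  then have "(\<Sum>k<N. g k) = 0"
    using Suc.prems(2)
    by (simp add: g_def module_hom.sum[OF hom_s] module_hom.add[OF hom_s] scale_sum_right
          algebra_simps sum_subtractf)
  moreover have "inj_on qn {..<N}" using Suc.prems(1) by (rule inj_on_subset) auto
  moreover have "\<forall>k<N. s 0 (g k) = qn k \<cdot> g k"
    using Suc.prems(2) by (simp add: g_def s_scale mult.commute)
  ultimately have "g k = 0" if "k < N" for k using Suc.IH[of g] that by blast
  then have fk: "f k = 0" if "k < N" for k
    using that Suc.prems(1) by (fastforce simp: g_def dest: inj_onD)
  then have "f N = 0" using Suc.prems(3) by simp
  then show ?case using fk Suc.prems(4) less_Suc_eq by blast
qed simp

end

section \<open>The action on tensors\<close>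

abbreviation linT :: "(tens \<Rightarrow> tens) \<Rightarrow> bool" where
  "linT \<equiv> module_hom scaleT scaleT"

global_interpretation tens_pair: module_pair scaleT scaleT
  by unfold_locales

lemma lin_ext_superset:
  assumes "finite S" "Poly_Mapping.keys x \<subseteq> S"
  shows "lin_ext f x = (\<Sum>w\<in>S. scaleT (Poly_Mapping.lookup x w) (f w))"
  unfolding lin_ext_def using assms by (intro sum.mono_neutral_left) (auto simp: in_keys_iff)

lemma linT_lin_ext: "linT (lin_ext f)"
proof -
  have "lin_ext f (x + y) = lin_ext f x + lin_ext f y" for x y
  proof -
    let ?S = "Poly_Mapping.keys x \<union> Poly_Mapping.keys y"
    have "Poly_Mapping.keys (x + y) \<subseteq> ?S" by (rule Poly_Mapping.keys_add)
    then show ?thesis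
      by (simp add: lin_ext_superset[of ?S] lookup_add tens.scale_left_distrib sum.distrib)
  qed
  moreover have "lin_ext f (scaleT c x) = scaleT c (lin_ext f x)" for c x
  proof -
    have "Poly_Mapping.keys (scaleT c x) \<subseteq> Poly_Mapping.keys x"
      by (auto simp: in_keys_iff lookup_scaleT)
    then show ?thesis
      by (simp add: lin_ext_superset[of "Poly_Mapping.keys x"] lookup_scaleT tens.scale_sum_right)
  qed
  ultimately show ?thesis by (simp add: module_hom_iff tens.module_axioms)
qed

lemmas linT_add = module_hom.add and linT_scale = module_hom.scale
  and linT_sum = module_hom.sum and linT_zero = module_hom.zero
  and linT_diff = module_hom.diff and linT_uminus = module_hom.neg

lemma linT_comp: "linT f \<Longrightarrow> linT g \<Longrightarrow> linT (\<lambda>x. f (g x))"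
  using module_hom_compose[of scaleT scaleT g scaleT f] by (simp add: comp_def)

lemma linT_scaled: "linT f \<Longrightarrow> linT (\<lambda>x. scaleT c (f x))"
  by (rule tens_pair.module_hom_scale)

lemma linT_setsum: "(\<And>i. i \<in> I \<Longrightarrow> linT (f i)) \<Longrightarrow> linT (\<lambda>x. \<Sum>i\<in>I. f i x)"
  by (rule tens_pair.module_hom_sum) (auto simp: tens.module_axioms)

lemma linT_id: "linT (\<lambda>x. x)"
  by (simp add: module_hom_iff tens.module_axioms)

lemma lin_ext_basisT [simp]: "lin_ext f (basisT w) = f w"
  by (simp add: lin_ext_def basisT_def)

lemma linT_eq_on_tpow:
  assumes "linT f" "linT g" "\<And>w. w \<in> words m n \<Longrightarrow> f (basisT w) = g (basisT w)" "x \<in> tpow m n"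
  shows "f x = g x"
  using tens_pair.module_hom_eq_on_span[OF assms(1,2), of "basisT ` words m n" x] assms(3,4)
  by (auto simp: tpow_def)

lemma subspace_tpow: "tens.subspace (tpow m n)"
  by (simp add: tpow_def)

lemma basisT_tpow: "w \<in> words m n \<Longrightarrow> basisT w \<in> tpow m n"
  by (simp add: tpow_def tens.span_base)

lemma linT_tpow_into:
  assumes "linT f" "tens.subspace U" "\<And>w. w \<in> words m n \<Longrightarrow> f (basisT w) \<in> U" "x \<in> tpow m n"
  shows "f x \<in> U"
  using assms(4) unfolding tpow_def
proof (induction rule: tens.span_induct_alt)
  case base
  then show ?case using assms(1,2) by (simp add: linT_zero tens.subspace_0)
next
  case (step c x y)
  then show ?case using assms(1-3)
    by (auto simp: linT_add linT_scale intro!: tens.subspace_add tens.subspace_scale)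
qed

lemma finite_words: "finite (words m n)"
  using finite_lists_length_eq[of "{1..m}" n] by (simp add: words_def conj_commute)

lemma tensor_basisT [simp]: "basisT u \<otimes>\<^sub>T basisT v = basisT (u @ v)"
  by (simp add: tensor_def)

lemma linT_tensor_left: "linT (\<lambda>x. x \<otimes>\<^sub>T y)"
  unfolding tensor_def by (rule linT_lin_ext)

lemma linT_tensor_right: "linT (\<lambda>y. x \<otimes>\<^sub>T y)"
  unfolding tensor_def lin_ext_def[of _ x]
  by (intro linT_setsum linT_scaled linT_lin_ext)

lemma linT_YB_at: "linT (YB_at a)"
  unfolding YB_at_def tensor_map_def by (rule linT_lin_ext)

text \<open>Equal letters fall under the second branch, since swapping them changes nothing.\<close>

lemma YB_at_basisT:
  assumes "length u = a"
  shows "YB_at a (basisT (u @ i # j # v)) =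
    (if i < j then scaleT (1 - yK\<^sup>2) (basisT (u @ i # j # v)) + scaleT (yK\<^sup>2) (basisT (u @ j # i # v))
     else basisT (u @ j # i # v))"
  using assms
  by (auto simp: YB_at_def tensor_map_def YB_def Let_def numeral_2_eq_2
      linT_add[OF linT_tensor_left] linT_scale[OF linT_tensor_left]
      linT_add[OF linT_tensor_right] linT_scale[OF linT_tensor_right])

section \<open>Hecke relations for the negated Yang-Baxter operator\<close>

definition neg_YB :: "nat \<Rightarrow> tens \<Rightarrow> tens" where
  "neg_YB a x = scaleT (-1) (YB_at a x)"

lemma linT_neg_YB: "linT (neg_YB a)"
  unfolding neg_YB_def[abs_def] by (intro linT_scaled linT_YB_at)

lemmas neg_YB_add = linT_add[OF linT_neg_YB] and neg_YB_scale = linT_scale[OF linT_neg_YB]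
  and neg_YB_uminus = linT_uminus[OF linT_neg_YB] and neg_YB_diff = linT_diff[OF linT_neg_YB]

lemma neg_YB_basisT:
  assumes "length u = a"
  shows "neg_YB a (basisT (u @ i # j # v)) =
    (if i < j then scaleT (yK\<^sup>2 - 1) (basisT (u @ i # j # v)) - scaleT (yK\<^sup>2) (basisT (u @ j # i # v))
     else - basisT (u @ j # i # v))"
  by (simp add: neg_YB_def YB_at_basisT[OF assms] tens.scale_right_distrib algebra_simps)

lemma split_word2:
  assumes "w \<in> words m n" "Suc a < n"
  obtains u i j v where "w = u @ i # j # v" "length u = a"
proof
  show "w = take a w @ w ! a # w ! Suc a # drop (Suc (Suc a)) w"
    using assms by (simp add: words_def Cons_nth_drop_Suc)
qed (use assms in \<open>auto simp: words_def\<close>)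

lemma split_word3:
  assumes "w \<in> words m n" "Suc (Suc a) < n"
  obtains u i j k v where "w = u @ i # j # k # v" "length u = a"
proof
  show "w = take a w @ w ! a # w ! Suc a # w ! Suc (Suc a) # drop (Suc (Suc (Suc a))) w"
    using assms by (simp add: words_def Cons_nth_drop_Suc)
qed (use assms in \<open>auto simp: words_def\<close>)

lemma split_word22:
  assumes "w \<in> words m n" "Suc a < b" "Suc b < n"
  obtains u i j v k l z where "w = u @ i # j # v @ k # l # z" "length u = a" "length (u @ i # j # v) = b"
proof -
  obtain u' k l z where 1: "w = u' @ k # l # z" "length u' = b"
    using split_word2 assms by metis
  then have "u' \<in> words m b" using assms(1) by (auto simp: words_def)
  then obtain u i j v where "u' = u @ i # j # v" "length u = a"
    using split_word2 assms(2) by metis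
  with 1 show ?thesis by (intro that[of u i j v k l z]) auto
qed

lemma neg_YB_closed:
  assumes "x \<in> tpow m n" "Suc a < n"
  shows "neg_YB a x \<in> tpow m n"
proof (rule linT_tpow_into[OF linT_neg_YB subspace_tpow _ assms(1)])
  fix w assume w: "w \<in> words m n"
  then obtain u i j v where e: "w = u @ i # j # v" "length u = a"
    using split_word2 assms(2) by metis
  then have "u @ j # i # v \<in> words m n" using w by (auto simp: words_def)
  then show "neg_YB a (basisT w) \<in> tpow m n"
    using w unfolding e
    by (auto simp: neg_YB_basisT[OF e(2)] intro!: tens.subspace_diff tens.subspace_neg
        tens.subspace_scale subspace_tpow basisT_tpow)
qed

lemma neg_YB_basisT1: "length u = a \<Longrightarrow>
    neg_YB (Suc a) (basisT (u @ h # i # j # v)) =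
    (if i < j then scaleT (yK\<^sup>2 - 1) (basisT (u @ h # i # j # v)) - scaleT (yK\<^sup>2) (basisT (u @ h # j # i # v))
     else - basisT (u @ h # j # i # v))"
  using neg_YB_basisT[of "u @ [h]" "Suc a" i j v] by simp

lemma neg_YB_basisT2: "length (u @ i' # j' # u') = a \<Longrightarrow>
    neg_YB a (basisT (u @ i' # j' # u' @ i # j # v)) =
    (if i < j then scaleT (yK\<^sup>2 - 1) (basisT (u @ i' # j' # u' @ i # j # v)) -
      scaleT (yK\<^sup>2) (basisT (u @ i' # j' # u' @ j # i # v))
     else - basisT (u @ i' # j' # u' @ j # i # v))"
  using neg_YB_basisT[of "u @ i' # j' # u'" a i j v] by simp

lemmas lookups = lookup_add lookup_minus lookup_scaleT lookup_uminus
lemmas neg_YB_lin = neg_YB_add neg_YB_scale neg_YB_diff neg_YB_uminus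

lemma neg_YB_quadratic:
  assumes "x \<in> tpow m n" "Suc a < n"
  shows "neg_YB a (neg_YB a x) = scaleT (yK\<^sup>2 - 1) (neg_YB a x) + scaleT (yK\<^sup>2) x"
proof (rule linT_eq_on_tpow[OF _ _ _ assms(1)])
  fix w assume w: "w \<in> words m n"
  then obtain u i j v where e: "w = u @ i # j # v" "length u = a"
    using split_word2 assms(2) by metis
  \<comment> \<open>With \<open>q\<close> opaque and tensors compared coefficient by coefficient,
    each order of the letters leaves polynomial identities in \<open>q\<close>. The next two proofs
    work the same way.\<close>
  define q where "q = yK\<^sup>2"
  show "neg_YB a (neg_YB a (basisT w)) = scaleT (yK\<^sup>2 - 1) (neg_YB a (basisT w)) + scaleT (yK\<^sup>2) (basisT w)"
    unfolding e(1)
    by (cases i j rule: linorder_cases; rule poly_mapping_eqI)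
      (simp_all add: neg_YB_basisT[OF e(2), folded q_def] neg_YB_lin lookups
        left_diff_distrib right_diff_distrib flip: q_def)
qed (intro linT_id linT_comp[OF linT_neg_YB] linT_scaled tens_pair.module_hom_add)+

lemma neg_YB_braid:
  assumes "x \<in> tpow m n" "Suc (Suc a) < n"
  shows "neg_YB a (neg_YB (Suc a) (neg_YB a x)) = neg_YB (Suc a) (neg_YB a (neg_YB (Suc a) x))"
proof (rule linT_eq_on_tpow[OF _ _ _ assms(1)])
  fix w assume w: "w \<in> words m n"
  then obtain u i j k v where e: "w = u @ i # j # k # v" "length u = a"
    using split_word3 assms(2) by metis
  define q where "q = yK\<^sup>2"
  show "neg_YB a (neg_YB (Suc a) (neg_YB a (basisT w))) = neg_YB (Suc a) (neg_YB a (neg_YB (Suc a) (basisT w)))"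
    unfolding e(1)
    by (cases i j rule: linorder_cases; cases j k rule: linorder_cases;
        cases i k rule: linorder_cases; rule poly_mapping_eqI)
      (simp_all add: neg_YB_basisT[OF e(2), folded q_def] neg_YB_basisT1[OF e(2), folded q_def]
        neg_YB_lin lookups algebra_simps flip: q_def)
qed (intro linT_id linT_comp[OF linT_neg_YB])+

lemma neg_YB_commute:
  assumes "x \<in> tpow m n" "Suc a < b" "Suc b < n"
  shows "neg_YB a (neg_YB b x) = neg_YB b (neg_YB a x)"
proof (rule linT_eq_on_tpow[OF _ _ _ assms(1)])
  fix w assume w: "w \<in> words m n"
  then obtain u i j v k l z where e: "w = u @ i # j # v @ k # l # z" "length u = a" "length (u @ i # j # v) = b"
    using split_word22 assms(2,3) by metis
  have e3: "length (u @ j # i # v) = b" using e(3) by simp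
  define q where "q = yK\<^sup>2"
  show "neg_YB a (neg_YB b (basisT w)) = neg_YB b (neg_YB a (basisT w))"
    unfolding e(1)
    by (cases "i < j"; cases "k < l"; rule poly_mapping_eqI)
      (simp_all add: neg_YB_basisT[OF e(2), folded q_def] neg_YB_basisT2[OF e(3), folded q_def]
        neg_YB_basisT2[OF e3, folded q_def] neg_YB_lin lookups algebra_simps)
qed (intro linT_id linT_comp[OF linT_neg_YB])+

section \<open>Distinct q-integers and characteristic zero\<close>

lemma yK_power: "yK ^ k = Fract ([:0, 1:] ^ k) 1"
  by (induction k) (auto simp: yK_def One_fract_def)

lemma q_int_Fract: "q_int k = Fract (\<Sum>i<k. [:0, 1:] ^ (2 * i)) 1"
  by (induction k) (auto simp: q_int_def yK_power Zero_fract_def)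

text \<open>At \<open>y = 1\<close> the polynomial of \<open>q_int k\<close> takes the value
  \<open>k\<close>.\<close>

lemma inj_q_int: "inj q_int"
proof (rule injI)
  fix k l assume "q_int k = q_int l"
  then have "(\<Sum>i<k. [:0, 1:] ^ (2 * i)) = (\<Sum>i<l. [:0, 1 :: complex:] ^ (2 * i))"
    by (simp add: q_int_Fract eq_fract)
  then have "poly (\<Sum>i<k. [:0, 1:] ^ (2 * i)) 1 = poly (\<Sum>i<l. [:0, 1 :: complex:] ^ (2 * i)) 1"
    by simp
  then show "k = l" by (simp add: poly_sum)
qed

lemma yK_sq_nonzero: "yK\<^sup>2 \<noteq> 0"
  by (simp add: yK_power Zero_fract_def eq_fract)

text \<open>Characteristic zero permits the later divisions by 2 and by
  \<open>fact k\<close>.\<close>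

lemma of_nat_ratfun_eq_0_iff: "(of_nat k :: ratfun) = 0 \<longleftrightarrow> k = 0"
proof -
  have "(of_nat k :: ratfun) = Fract (of_nat k) 1"
    by (induction k) (auto simp: Zero_fract_def One_fract_def)
  then show ?thesis by (simp add: Zero_fract_def eq_fract)
qed

lemma one_plus_q_nonzero: "1 + yK\<^sup>2 \<noteq> 0"
  using injD[OF inj_q_int, of 2 0] by (auto simp: q_int_def numeral_2_eq_2)

lemma hecke: "hecke_action scaleT (tpow m n) neg_YB (yK\<^sup>2) n"
proof (intro hecke_action.intro hecke_action_axioms.intro)
  show "vector_space scaleT" ..
  show "Vector_Spaces.linear scaleT scaleT (neg_YB a)" for a
    using linT_neg_YB by (simp add: linear_iff_module_hom)
qed (fact subspace_tpow neg_YB_closed neg_YB_quadratic neg_YB_commute neg_YB_braid yK_sq_nonzero)+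

section \<open>Identification of \<open>s 0\<close> with \<open>sigma n\<close>\<close>

context
  fixes m n :: nat
begin

interpretation H: hecke_action scaleT "tpow m n" neg_YB "yK\<^sup>2" n
  by (rule hecke)

lemma path_eq_YB_at:
  "H.path j k x = scaleT ((-1) ^ k) (foldr (\<circ>) (map YB_at [j..<j + k]) id x)"
proof (induction k arbitrary: j)
  case (Suc k)
  have upt: "[j..<j + Suc k] = j # [Suc j..<Suc j + k]"
    using upt_conv_Cons[of j "j + Suc k"] by simp
  have "H.path j (Suc k) x = neg_YB j (H.path (Suc j) k x)" by simp
  also have "\<dots> = scaleT ((-1) ^ Suc k) (YB_at j (foldr (\<circ>) (map YB_at [Suc j..<Suc j + k]) id x))"
    unfolding Suc neg_YB_def linT_scale[OF linT_YB_at] by simp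
  also have "YB_at j (foldr (\<circ>) (map YB_at [Suc j..<Suc j + k]) id x) =
      foldr (\<circ>) (map YB_at [j..<j + Suc k]) id x"
    unfolding upt by simp
  finally show ?case .
qed simp

lemma s_eq_sigma: "H.s 0 x = sigma n x"
proof -
  have "sigma n x = (\<Sum>k<n. scaleT ((-1) ^ k) (dmap (Suc k) x))"
    unfolding sigma_def
    by (rule sum.reindex_bij_witness[of _ Suc "\<lambda>k. k - 1"]) auto
  then show ?thesis
    by (simp add: H.s_def path_eq_YB_at dmap_def)
qed

lemma qn_eq_q_int: "H.qn k = q_int k"
  by (simp add: H.qn_def q_int_def power_mult)

end

section \<open>Splitting off the first tensor factors\<close>

definition slice :: "nat list \<Rightarrow> tens \<Rightarrow> tens" where
  "slice u = lin_ext (\<lambda>w. if take (length u) w = u then basisT (drop (length u) w) else 0)"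

lemma linT_slice: "linT (slice u)"
  unfolding slice_def by (rule linT_lin_ext)

lemma slice_basisT_append:
  "length v = length u \<Longrightarrow> slice u (basisT (v @ w)) = (if v = u then basisT w else 0)"
  by (simp add: slice_def)

lemma words_split:
  assumes "w \<in> words m n" "k \<le> n"
  obtains u v where "w = u @ v" "length u = k" "u \<in> words m k" "v \<in> words m (n - k)"
proof
  show "w = take k w @ drop k w" by simp
qed (use assms in \<open>auto simp: words_def dest: in_set_takeD in_set_dropD\<close>)

lemma slice_closed:
  assumes "x \<in> tpow m n" "length u = k" "k \<le> n"
  shows "slice u x \<in> tpow m (n - k)"
proof (rule linT_tpow_into[OF linT_slice subspace_tpow _ assms(1)])
  fix w assume "w \<in> words m n"
  then obtain v z where "w = v @ z" "length v = k" "z \<in> words m (n - k)"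
    using words_split assms(3) by metis
  then show "slice u (basisT w) \<in> tpow m (n - k)"
    using assms(2) by (auto simp: slice_basisT_append basisT_tpow tens.subspace_0 subspace_tpow)
qed

text \<open>\<open>slice u\<close> contracts the first factors with the dual basis vector of
  \<open>u\<close>, so it extracts the component of \<open>x\<close> behind the word
  \<open>u\<close>.\<close>

lemma sum_slices:
  assumes "x \<in> tpow m n" "k \<le> n"
  shows "x = (\<Sum>u\<in>words m k. basisT u \<otimes>\<^sub>T slice u x)"
proof (rule linT_eq_on_tpow[OF _ _ _ assms(1)])
  fix w assume "w \<in> words m n"
  then obtain v z where e: "w = v @ z" "length v = k" "v \<in> words m k"
    using words_split assms(2) by metis
  have "(\<Sum>u\<in>words m k. basisT u \<otimes>\<^sub>T slice u (basisT w)) =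
      (\<Sum>u\<in>words m k. if u = v then basisT w else 0)"
    using e by (intro sum.cong refl)
      (auto simp: slice_basisT_append words_def linT_zero[OF linT_tensor_right])
  then show "basisT w = (\<Sum>u\<in>words m k. basisT u \<otimes>\<^sub>T slice u (basisT w))"
    using e finite_words by simp
qed (intro linT_id linT_setsum linT_comp[OF linT_tensor_right] linT_slice)+

lemma neg_YB_basisT_append:
  assumes "length u = k" "w \<in> words m r" "Suc b < r"
  shows "neg_YB (k + b) (basisT (u @ w)) = basisT u \<otimes>\<^sub>T neg_YB b (basisT w)"
proof -
  obtain u' i j v where e: "w = u' @ i # j # v" "length u' = b"
    using split_word2 assms(2,3) by metis
  have "length (u @ u') = k + b" using assms e by simp
  from neg_YB_basisT[OF this, of i j v] show ?thesis
    by (simp add: e neg_YB_basisT linT_diff[OF linT_tensor_right] linT_scale[OF linT_tensor_right]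
        linT_uminus[OF linT_tensor_right])
qed

lemma slice_tensor:
  assumes "length u = length v" "x \<in> tpow m r"
  shows "slice u (basisT v \<otimes>\<^sub>T x) = (if v = u then x else 0)"
proof (rule linT_eq_on_tpow[OF _ _ _ assms(2)])
  show "linT (\<lambda>x. if v = u then x else 0)"
    by (auto simp: module_hom_iff tens.module_axioms)
  show "linT (\<lambda>x. slice u (basisT v \<otimes>\<^sub>T x))"
    by (intro linT_comp[OF linT_slice linT_tensor_right])
qed (use assms(1) in \<open>simp add: slice_basisT_append\<close>)

lemma neg_YB_tensor:
  assumes "length u = k" "x \<in> tpow m r" "Suc b < r"
  shows "neg_YB (k + b) (basisT u \<otimes>\<^sub>T x) = basisT u \<otimes>\<^sub>T neg_YB b x"
  by (rule linT_eq_on_tpow[OF _ _ _ assms(2)])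
    (use assms in \<open>simp_all add: neg_YB_basisT_append linT_comp[OF linT_neg_YB]
        linT_comp[OF linT_tensor_right] linT_neg_YB linT_tensor_right\<close>)

lemma tensor_closed:
  assumes "u \<in> words m k" "x \<in> tpow m (n - k)" "k \<le> n"
  shows "basisT u \<otimes>\<^sub>T x \<in> tpow m n"
  by (rule linT_tpow_into[OF linT_tensor_right subspace_tpow _ assms(2)])
    (use assms in \<open>auto intro!: basisT_tpow simp: words_def\<close>)

lemma path_tensor:
  assumes "length u = k" "x \<in> tpow m r"
  shows "j + l < r \<Longrightarrow> hecke_action.path neg_YB (k + j) l (basisT u \<otimes>\<^sub>T x) =
      basisT u \<otimes>\<^sub>T hecke_action.path neg_YB j l x"
proof (induction l arbitrary: j)
  case 0
  interpret H: hecke_action scaleT "tpow m r" neg_YB "yK\<^sup>2" r by (rule hecke)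
  show ?case by simp
next
  case (Suc l)
  interpret H: hecke_action scaleT "tpow m r" neg_YB "yK\<^sup>2" r by (rule hecke)
  have "H.path (Suc j) l x \<in> tpow m r"
    using Suc.prems assms by (intro H.path_closed) auto
  then show ?case
    using Suc.IH[of "Suc j"] Suc.prems neg_YB_tensor[OF assms(1), of "H.path (Suc j) l x" m r j]
    by simp
qed

text \<open>\<open>s k\<close> involves only generators of index at least \<open>k\<close>. Behind a
  word of length \<open>k\<close> they act as generators with index lowered by \<open>k\<close>, so
  \<open>s k\<close> is the identity on \<open>k\<close> factors tensored with
  \<open>sigma (n - k)\<close>.\<close>

lemma s_tensor:
  assumes "length u = k" "x \<in> tpow m (n - k)"
  shows "hecke_action.s neg_YB n k (basisT u \<otimes>\<^sub>T x) = basisT u \<otimes>\<^sub>T sigma (n - k) x"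
proof -
  interpret H: hecke_action scaleT "tpow m n" neg_YB "yK\<^sup>2" n by (rule hecke)
  interpret H': hecke_action scaleT "tpow m (n - k)" neg_YB "yK\<^sup>2" "n - k" by (rule hecke)
  show ?thesis
    using path_tensor[OF assms, of 0]
    by (simp add: s_eq_sigma[symmetric] H.s_def H'.s_def linT_sum[OF linT_tensor_right])
qed

lemma sigma_closed: "x \<in> tpow m n \<Longrightarrow> sigma n x \<in> tpow m n"
proof -
  interpret H: hecke_action scaleT "tpow m n" neg_YB "yK\<^sup>2" n by (rule hecke)
  show "x \<in> tpow m n \<Longrightarrow> sigma n x \<in> tpow m n"
    using H.s_closed[of x 0] by (simp add: s_eq_sigma)
qed

lemma linT_sigma: "linT (sigma n)"
proof -
  \<comment> \<open>Linearity of \<open>s 0\<close> holds on all of \<open>tens\<close>, so any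
    alphabet size serves.\<close>
  interpret H: hecke_action scaleT "tpow 0 n" neg_YB "yK\<^sup>2" n by (rule hecke)
  show ?thesis using H.hom_s[of 0] by (simp add: s_eq_sigma[abs_def])
qed

text \<open>\<open>sigma 0\<close> is an empty sum, so the separate clause for degree 0 agrees with
  the kernel.\<close>

lemma ker_sigma_eq: "ker_sigma m n = {x \<in> tpow m n. sigma n x = 0}"
  by (simp add: ker_sigma_def sigma_def)

text \<open>Apply \<open>s k\<close> to the expansion of \<open>x\<close> by first words: each
  component is hit by \<open>sigma (n - k)\<close>, and slicing at \<open>u\<close> isolates one of
  them.\<close>

lemma slice_ker_sigma:
  assumes x: "x \<in> tpow m n" "k \<le> n" "hecke_action.s neg_YB n k x = 0" and u: "u \<in> words m k"
  shows "slice u x \<in> ker_sigma m (n - k)"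
proof -
  interpret H: hecke_action scaleT "tpow m n" neg_YB "yK\<^sup>2" n by (rule hecke)
  have len: "length v = k" if "v \<in> words m k" for v using that by (simp add: words_def)
  have sl: "slice v x \<in> tpow m (n - k)" if "v \<in> words m k" for v
    using slice_closed x(1,2) len[OF that] by blast
  have "0 = slice u (H.s k (\<Sum>v\<in>words m k. basisT v \<otimes>\<^sub>T slice v x))"
    unfolding sum_slices[OF x(1,2), symmetric] x(3) by (simp add: linT_zero[OF linT_slice])
  also have "\<dots> = (\<Sum>v\<in>words m k. slice u (basisT v \<otimes>\<^sub>T sigma (n - k) (slice v x)))"
    unfolding linT_sum[OF H.hom_s] linT_sum[OF linT_slice]
    by (intro sum.cong refl arg_cong[of _ _ "slice u"] s_tensor[OF len sl])
  also have "\<dots> = (\<Sum>v\<in>words m k. if v = u then sigma (n - k) (slice v x) else 0)"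
    using len[OF u] by (intro sum.cong refl slice_tensor[where m = m and r = "n - k"])
      (simp_all add: len sl sigma_closed)
  also have "\<dots> = sigma (n - k) (slice u x)"
    using u finite_words by simp
  finally show ?thesis using sl[OF u] by (simp add: ker_sigma_eq)
qed

section \<open>Antisymmetric tensors\<close>

definition perm :: "(nat \<Rightarrow> nat) \<Rightarrow> tens \<Rightarrow> tens" where
  "perm \<tau> = lin_ext (\<lambda>w. basisT (permute_list \<tau> w))"

lemma linT_perm: "linT (perm \<tau>)"
  unfolding perm_def by (rule linT_lin_ext)

lemma perm_basisT [simp]: "perm \<tau> (basisT w) = basisT (permute_list \<tau> w)"
  by (simp add: perm_def)

lemma permute_list_words:
  "w \<in> words m n \<Longrightarrow> \<tau> permutes {..<n} \<Longrightarrow> permute_list \<tau> w \<in> words m n"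
  by (simp add: words_def set_permute_list)

text \<open>Permutations of places act from the right, hence the reversed order.\<close>

lemma perm_compose:
  assumes "x \<in> tpow m n" "\<tau> permutes {..<n}"
  shows "perm (\<rho> \<circ> \<tau>) x = perm \<tau> (perm \<rho> x)"
proof (rule linT_eq_on_tpow[OF _ _ _ assms(1)])
  fix w assume "w \<in> words m n"
  then have "permute_list (\<rho> \<circ> \<tau>) w = permute_list \<tau> (permute_list \<rho> w)"
    using assms(2) by (intro permute_list_compose) (simp add: words_def)
  then show "perm (\<rho> \<circ> \<tau>) (basisT w) = perm \<tau> (perm \<rho> (basisT w))"
    by (simp only: perm_basisT)
qed (intro linT_perm linT_comp[OF linT_perm])+

lemma permute_list_append:
  assumes "\<tau> permutes {..<length u}"
  shows "permute_list \<tau> (u @ v) = permute_list \<tau> u @ v"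
proof (rule nth_equalityI)
  have \<tau>: "\<tau> permutes {..<length (u @ v)}"
    using permutes_subset[OF assms] by auto
  fix i assume "i < length (permute_list \<tau> (u @ v))"
  then show "permute_list \<tau> (u @ v) ! i = (permute_list \<tau> u @ v) ! i"
    using permutes_in_image[OF assms, of i] permutes_not_in[OF assms, of i] \<tau> assms
    by (auto simp: permute_list_nth nth_append)
qed simp

lemma permute_list_adjacent:
  assumes "length u = a"
  shows "permute_list (transpose a (Suc a)) (u @ i # j # v) = u @ j # i # v"
proof (rule nth_equalityI)
  have t: "transpose a (Suc a) permutes {..<length (u @ i # j # v)}"
    using assms by (intro permutes_swap_id) auto
  fix r assume "r < length (permute_list (transpose a (Suc a)) (u @ i # j # v))"
  then show "permute_list (transpose a (Suc a)) (u @ i # j # v) ! r = (u @ j # i # v) ! r"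
    using t assms by (auto simp: permute_list_nth nth_append nth_Cons' transpose_def)
qed simp

text \<open>With \<open>T = neg_YB a\<close> and \<open>P\<close> the swap,
  \<open>P (T + 1) = -(T + 1)\<close> and \<open>(T - q)(1 - P) = 0\<close>. If
  \<open>T x = q x\<close>, then \<open>(T + 1) x\<close> is a nonzero multiple of \<open>x\<close>;
  if \<open>P x = -x\<close>, then \<open>(1 - P) x = 2 x\<close>.\<close>

lemma neg_YB_eigen_iff:
  assumes x: "x \<in> tpow m n" and a: "Suc a < n"
  shows "neg_YB a x = scaleT (yK\<^sup>2) x \<longleftrightarrow> perm (transpose a (Suc a)) x = - x"
proof -
  let ?P = "perm (transpose a (Suc a))"
  have 1: "?P (neg_YB a x) + ?P x = - (neg_YB a x + x)"
  proof (rule linT_eq_on_tpow[OF _ _ _ x])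
    fix w assume "w \<in> words m n"
    then obtain u i j v where e: "w = u @ i # j # v" "length u = a"
      using split_word2 a by metis
    show "?P (neg_YB a (basisT w)) + ?P (basisT w) = - (neg_YB a (basisT w) + basisT w)"
      by (simp add: e neg_YB_basisT permute_list_adjacent linT_diff[OF linT_perm] linT_scale[OF linT_perm]
        linT_uminus[OF linT_perm] tens.scale_left_diff_distrib)
  qed (intro linT_id linT_perm linT_neg_YB linT_comp[OF linT_perm]
      tens_pair.module_hom_add tens_pair.module_hom_neg)+
  have 2: "neg_YB a (x - ?P x) = scaleT (yK\<^sup>2) (x - ?P x)"
  proof (rule linT_eq_on_tpow[OF _ _ _ x])
    fix w assume "w \<in> words m n"
    then obtain u i j v where e: "w = u @ i # j # v" "length u = a"
      using split_word2 a by metis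
    show "neg_YB a (basisT w - ?P (basisT w)) = scaleT (yK\<^sup>2) (basisT w - ?P (basisT w))"
      by (cases i j rule: linorder_cases)
        (simp_all add: e neg_YB_basisT permute_list_adjacent neg_YB_diff tens.scale_left_diff_distrib
          tens.scale_right_diff_distrib linT_zero[OF linT_neg_YB])
  qed (intro linT_id linT_perm linT_neg_YB linT_comp[OF linT_neg_YB]
      tens_pair.module_hom_sub linT_scaled)+
  show ?thesis
  proof
    assume eig: "neg_YB a x = scaleT (yK\<^sup>2) x"
    have "scaleT (1 + yK\<^sup>2) (?P x + x) = (?P (neg_YB a x) + ?P x) + (neg_YB a x + x)"
      by (simp only: eig linT_scale[OF linT_perm] tens.scale_left_distrib tens.scale_right_distrib
          tens.scale_one add_ac)
    then have "scaleT (1 + yK\<^sup>2) (?P x + x) = 0"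
      unfolding 1 by simp
    then show "?P x = - x"
      using one_plus_q_nonzero by (simp only: tens.scale_eq_0_iff eq_neg_iff_add_eq_0) simp
  next
    assume "?P x = - x"
    then have "neg_YB a x + neg_YB a x = scaleT (yK\<^sup>2) x + scaleT (yK\<^sup>2) x"
      using 2 by (simp add: neg_YB_add tens.scale_right_distrib)
    then have "scaleT 2 (neg_YB a x) = scaleT 2 (scaleT (yK\<^sup>2) x)"
      using tens.scale_left_distrib[of 1 1] by (simp del: tens.scale_scale)
    then show "neg_YB a x = scaleT (yK\<^sup>2) x"
      using of_nat_ratfun_eq_0_iff[of 2] by (simp only: tens.scale_cancel_left) simp
  qed
qed

lemma perm_sign:
  assumes x: "x \<in> tpow m n" "k \<le> n"
    and adj: "\<And>a. Suc a < k \<Longrightarrow> perm (transpose a (Suc a)) x = - x"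
    and \<tau>: "\<tau> permutes {..<k}"
  shows "perm \<tau> x = scaleT (of_int (sign \<tau>)) x"
proof -
  have transp: "transpose a b permutes {..<n}" if "a < k" "b < k" for a b
    using that x(2) by (intro permutes_swap_id) auto
  have less: "b < k \<Longrightarrow> perm (transpose a b) x = - x" if "a < b" for a b
    using that
  proof (induction b rule: less_Suc_induct)
    case (1 a)
    then show ?case by (rule adj)
  next
    case (2 a b c)
    \<comment> \<open>A longer transposition is a product of three shorter ones, each contributing
      one sign.\<close>
    have "transpose a c = transpose a b \<circ> (transpose b c \<circ> transpose a b)"
      using transpose_comp_triple[of a c b] 2 by (simp add: comp_assoc)
    moreover have "transpose b c \<circ> transpose a b permutes {..<n}"
      using 2 by (intro permutes_compose transp) auto
    ultimately have "perm (transpose a c) x =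
        perm (transpose b c \<circ> transpose a b) (perm (transpose a b) x)"
      using perm_compose[OF x(1)] by metis
    also have "\<dots> = - perm (transpose a b) (perm (transpose b c) x)"
      using 2 transp[of a b] perm_compose[OF x(1), of "transpose a b" "transpose b c"]
      by (simp add: linT_uminus[OF linT_perm])
    finally show ?case using 2 by (simp add: linT_uminus[OF linT_perm])
  qed
  have neq: "perm (transpose a b) x = - x" if "a < k" "b < k" "a \<noteq> b" for a b
    using that less[of a b] less[of b a] by (cases "a < b") (auto simp: transpose_commute)
  from \<tau> finite_lessThan show ?thesis
  proof (induction rule: permutes_induct)
    case id
    have "perm (\<lambda>a. a) x = x"
      by (rule linT_eq_on_tpow[OF linT_perm linT_id _ x(1)]) simp
    then show ?case by simp
  next
    case (swap a b p)
    have p: "p permutes {..<n}" using \<open>p permutes {..<k}\<close> x(2) by (auto intro: permutes_subset)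
    have "sign (transpose a b \<circ> p) = - sign p"
      using swap by (subst sign_compose)
        (auto simp: sign_swap_id intro: permutation_swap_id permutes_imp_permutation[of "{..<k}"])
    moreover have "perm (transpose a b \<circ> p) x = - scaleT (of_int (sign p)) x"
      using swap unfolding perm_compose[OF x(1) p] by (simp add: neq linT_uminus[OF linT_perm])
    ultimately show ?case by (simp only: of_int_minus tens.scale_minus_left)
  qed
qed

text \<open>The antisymmetrizer of the first \<open>k\<close> places, without the factor
  \<open>1 / k!\<close>.\<close>

definition alternate :: "nat \<Rightarrow> tens \<Rightarrow> tens" where
  "alternate k x = (\<Sum>\<tau> | \<tau> permutes {..<k}. scaleT (of_int (sign \<tau>)) (perm \<tau> x))"

lemma linT_alternate: "linT (alternate k)"
  unfolding alternate_def[abs_def] by (intro linT_setsum linT_scaled linT_perm)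

lemma alternate_tensor:
  assumes "length u = k" "x \<in> tpow m r"
  shows "alternate k (basisT u \<otimes>\<^sub>T x) = bracket u \<otimes>\<^sub>T x"
proof (rule linT_eq_on_tpow[OF _ _ _ assms(2)])
  fix w
  show "alternate k (basisT u \<otimes>\<^sub>T basisT w) = bracket u \<otimes>\<^sub>T basisT w"
    using assms(1) unfolding alternate_def bracket_def linT_sum[OF linT_tensor_left]
    by (intro sum.cong) (auto simp: linT_scale[OF linT_tensor_left] permute_list_append)
qed (intro linT_comp[OF linT_alternate] linT_tensor_right)+

text \<open>Reindexing the sum by composition with the transposition flips every sign.\<close>

lemma perm_alternate:
  assumes x: "x \<in> tpow m n" and a: "Suc a < k" and k: "k \<le> n"
  shows "perm (transpose a (Suc a)) (alternate k x) = - alternate k x"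
proof -
  let ?t = "transpose a (Suc a)"
  have t: "?t permutes {..<k}" using a by (intro permutes_swap_id) auto
  then have tn: "?t permutes {..<n}" using k by (auto intro: permutes_subset)
  have "alternate k x = (\<Sum>\<tau> | \<tau> permutes {..<k}. scaleT (of_int (sign (\<tau> \<circ> ?t))) (perm (\<tau> \<circ> ?t) x))"
    unfolding alternate_def by (rule sum_permutations_compose_right[OF t])
  also have "\<dots> = (\<Sum>\<tau> | \<tau> permutes {..<k}. - scaleT (of_int (sign \<tau>)) (perm ?t (perm \<tau> x)))"
  proof (intro sum.cong refl)
    fix \<tau> assume "\<tau> \<in> {\<tau>. \<tau> permutes {..<k}}"
    then have "sign (\<tau> \<circ> ?t) = - sign \<tau>"
      by (subst sign_compose)
        (auto simp: sign_swap_id intro: permutation_swap_id permutes_imp_permutation[of "{..<k}"])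
    then show "scaleT (of_int (sign (\<tau> \<circ> ?t))) (perm (\<tau> \<circ> ?t) x) =
        - scaleT (of_int (sign \<tau>)) (perm ?t (perm \<tau> x))"
      using perm_compose[OF x tn] by simp
  qed
  also have "\<dots> = - perm ?t (alternate k x)"
    by (simp add: alternate_def linT_sum[OF linT_perm] linT_scale[OF linT_perm] sum_negf)
  finally show ?thesis by (metis minus_minus)
qed

lemma alternate_closed:
  assumes "x \<in> tpow m n" "k \<le> n"
  shows "alternate k x \<in> tpow m n"
  unfolding alternate_def
proof (intro tens.subspace_sum tens.subspace_scale subspace_tpow)
  fix \<tau> assume "\<tau> \<in> {\<tau>. \<tau> permutes {..<k}}"
  then have "\<tau> permutes {..<n}" using assms(2) by (auto intro: permutes_subset)
  then show "perm \<tau> x \<in> tpow m n"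
    by (intro linT_tpow_into[OF linT_perm subspace_tpow _ assms(1)])
      (auto intro: basisT_tpow permute_list_words)
qed

section \<open>The eigenspaces of \<open>sigma n\<close> and their direct sum\<close>

lemma subspace_eigenspace: "tens.subspace (eigenspace m n c)"
  using subspace_tpow
  by (auto simp: tens.subspace_def eigenspace_def linT_add[OF linT_sigma]
      linT_scale[OF linT_sigma] linT_zero[OF linT_sigma]
      tens.scale_right_distrib mult.commute)

lemma tensor_space_eq_eigenspace:
  assumes k: "k \<le> n"
  shows "tensor_space (bracket_space m k) (ker_sigma m (n - k)) = eigenspace m n (q_int k)"
proof -
  interpret H: hecke_action scaleT "tpow m n" neg_YB "yK\<^sup>2" n by (rule hecke)
  \<comment> \<open>A description of the eigenspace by antisymmetry in the first \<open>k\<close>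
    places and a kernel condition on the rest, the two factors of the tensor product.\<close>
  have eig: "x \<in> eigenspace m n (q_int k) \<longleftrightarrow>
      x \<in> tpow m n \<and> (\<forall>a. Suc a < k \<longrightarrow> perm (transpose a (Suc a)) x = - x) \<and> H.s k x = 0" for x
  proof (cases "x \<in> tpow m n")
    case True
    have "q_int l \<noteq> q_int k" if "l < k" for l
      using that injD[OF inj_q_int, of l k] by auto
    then have "sigma n x = scaleT (q_int k) x \<longleftrightarrow> x \<in> H.W k \<and> H.s k x = 0"
      using H.eigenvector_iff[OF _ k True] by (simp only: qn_eq_q_int s_eq_sigma) blast
    moreover have "x \<in> H.W k \<longleftrightarrow> (\<forall>a. Suc a < k \<longrightarrow> perm (transpose a (Suc a)) x = - x)"
      using True k neg_YB_eigen_iff[OF True] unfolding H.W_def by simp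
    ultimately show ?thesis using True by (simp only: eigenspace_def mem_Collect_eq)
  qed (simp add: eigenspace_def)
  have br: "bracket u \<otimes>\<^sub>T z \<in> eigenspace m n (q_int k)"
    if u: "u \<in> words m k" and z: "z \<in> ker_sigma m (n - k)" for u z
  proof -
    have len: "length u = k" using u by (simp add: words_def)
    have zX: "z \<in> tpow m (n - k)" and sz: "sigma (n - k) z = 0"
      using z by (auto simp: ker_sigma_eq)
    have uz: "basisT u \<otimes>\<^sub>T z \<in> tpow m n" using tensor_closed[OF u zX k] .
    have b: "bracket u = (\<Sum>\<tau> | \<tau> permutes {..<k}. scaleT (of_int (sign \<tau>)) (basisT (permute_list \<tau> u)))"
      using len by (simp add: bracket_def)
    \<comment> \<open>Every term of the bracket is a word of length \<open>k\<close>, so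
      \<open>s k\<close> acts on \<open>z\<close> alone, as \<open>sigma (n - k)\<close>.\<close>
    have "H.s k (bracket u \<otimes>\<^sub>T z) = 0"
      unfolding b linT_sum[OF linT_tensor_left] linT_scale[OF linT_tensor_left]
        linT_sum[OF H.hom_s] linT_scale[OF H.hom_s]
      using len by (intro sum.neutral) (simp add: s_tensor[OF _ zX] sz linT_zero[OF linT_tensor_right])
    then show ?thesis
      unfolding eig alternate_tensor[OF len zX, symmetric]
      using alternate_closed perm_alternate uz k by blast
  qed
  have "b \<otimes>\<^sub>T z \<in> eigenspace m n (q_int k)"
    if "b \<in> bracket_space m k" "z \<in> ker_sigma m (n - k)" for b z
    using that(1) unfolding bracket_space_def
  proof (induction rule: tens.span_induct_alt)
    case base
    then show ?case using subspace_eigenspace by (simp add: linT_zero[OF linT_tensor_left] tens.subspace_0)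
  next
    case (step c x y)
    then show ?case using subspace_eigenspace that(2) br
      by (auto simp: linT_add[OF linT_tensor_left] linT_scale[OF linT_tensor_left]
          intro!: tens.subspace_add tens.subspace_scale)
  qed
  then have "tensor_space (bracket_space m k) (ker_sigma m (n - k)) \<subseteq> eigenspace m n (q_int k)"
    unfolding tensor_space_def by (intro tens.span_minimal subspace_eigenspace) blast
  moreover have "x \<in> tensor_space (bracket_space m k) (ker_sigma m (n - k))"
    if x: "x \<in> eigenspace m n (q_int k)" for x
  proof -
    have xX: "x \<in> tpow m n" and adj: "\<And>a. Suc a < k \<Longrightarrow> perm (transpose a (Suc a)) x = - x"
      and sx: "H.s k x = 0"
      using x unfolding eig by auto
    \<comment> \<open>The sign of each permutation occurs twice, once in \<open>alternate\<close>
      and once from its action on \<open>x\<close>, so all \<open>k!\<close> terms equal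
      \<open>x\<close>.\<close>
    have "alternate k x = (\<Sum>\<tau> | \<tau> permutes {..<k}. x)"
      unfolding alternate_def
    proof (intro sum.cong refl)
      fix \<tau> assume "\<tau> \<in> {\<tau>. \<tau> permutes {..<k}}"
      then have "perm \<tau> x = scaleT (of_int (sign \<tau>)) x"
        using perm_sign[OF xX k adj] by blast
      moreover have "of_int (sign \<tau>) * of_int (sign \<tau>) = (1 :: ratfun)"
        by (simp only: sign_idempotent of_int_1 flip: of_int_mult)
      ultimately show "scaleT (of_int (sign \<tau>)) (perm \<tau> x) = x" by simp
    qed
    also have "\<dots> = scaleT (of_nat (fact k)) x"
      by (simp add: tens.sum_constant_scale card_permutations)
    finally have "alternate k x = scaleT (of_nat (fact k)) x" .
    moreover have "inverse (of_nat (fact k)) * of_nat (fact k) = (1 :: ratfun)"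
      using of_nat_ratfun_eq_0_iff[of "fact k"] by (intro left_inverse) simp
    ultimately have "x = scaleT (inverse (of_nat (fact k))) (alternate k x)"
      by (simp only: tens.scale_scale tens.scale_one)
    \<comment> \<open>Antisymmetrizing the expansion of \<open>x\<close> by first words turns each
      word into its bracket.\<close>
    also have "alternate k x = (\<Sum>u\<in>words m k. bracket u \<otimes>\<^sub>T slice u x)"
    proof -
      have "alternate k (\<Sum>u\<in>words m k. basisT u \<otimes>\<^sub>T slice u x) =
          (\<Sum>u\<in>words m k. bracket u \<otimes>\<^sub>T slice u x)"
        unfolding linT_sum[OF linT_alternate]
        by (auto intro!: sum.cong alternate_tensor slice_closed[OF xX _ k] simp: words_def)
      then show ?thesis by (simp only: sum_slices[OF xX k, symmetric])
    qed
    finally have 1: "x = scaleT (inverse (of_nat (fact k))) (\<Sum>u\<in>words m k. bracket u \<otimes>\<^sub>T slice u x)" .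
    have "bracket u \<otimes>\<^sub>T slice u x \<in> tensor_space (bracket_space m k) (ker_sigma m (n - k))"
      if "u \<in> words m k" for u
      unfolding tensor_space_def
      using that slice_ker_sigma[OF xX k sx that]
      by (intro tens.span_base) (auto simp: bracket_space_def intro: tens.span_base)
    then show ?thesis
      by (subst 1) (auto simp: tensor_space_def intro!: tens.span_scale tens.span_sum)
  qed
  ultimately show ?thesis by blast
qed

lemma ker_sigma_eq_eigenspace: "ker_sigma m n = eigenspace m n 0"
  by (simp add: ker_sigma_eq eigenspace_def)

lemma is_direct_sum_eigenspaces:
  "is_direct_sum (tpow m n) {0..n} (\<lambda>k. eigenspace m n (q_int k))"
proof -
  interpret H: hecke_action scaleT "tpow m n" neg_YB "yK\<^sup>2" n by (rule hecke)
  have inj: "inj_on H.qn S" for S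
    using inj_q_int by (auto simp: inj_on_def qn_eq_q_int)
  have mem: "x \<in> eigenspace m n (q_int k) \<longleftrightarrow> x \<in> tpow m n \<and> H.s 0 x = scaleT (H.qn k) x" for x k
    by (simp add: eigenspace_def qn_eq_q_int s_eq_sigma)
  have "\<exists>!f. f \<in> (\<Pi>\<^sub>E k\<in>{0..n}. eigenspace m n (q_int k)) \<and> x = (\<Sum>k\<in>{0..n}. f k)"
    if x: "x \<in> tpow m n" for x
  proof (rule ex_ex1I)
    obtain f where "\<forall>k\<le>n. f k \<in> tpow m n \<and> H.s 0 (f k) = scaleT (H.qn k) (f k)" "x = (\<Sum>k\<le>n. f k)"
      using H.eigenvector_decomposition[OF inj x] by blast
    then show "\<exists>f. f \<in> (\<Pi>\<^sub>E k\<in>{0..n}. eigenspace m n (q_int k)) \<and> x = (\<Sum>k\<in>{0..n}. f k)"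
      \<comment> \<open>Members of the extensional product must be \<open>undefined\<close> outside
        the index set.\<close>
      by (intro exI[of _ "restrict f {0..n}"]) (auto simp: mem atLeast0AtMost)
  next
    fix f g
    assume f: "f \<in> (\<Pi>\<^sub>E k\<in>{0..n}. eigenspace m n (q_int k)) \<and> x = (\<Sum>k\<in>{0..n}. f k)"
      and g: "g \<in> (\<Pi>\<^sub>E k\<in>{0..n}. eigenspace m n (q_int k)) \<and> x = (\<Sum>k\<in>{0..n}. g k)"
    have "f k - g k = 0" if "k < Suc n" for k
    proof (rule H.eigenvectors_independent[OF inj _ _ that, of "\<lambda>k. f k - g k"])
      show "\<forall>k<Suc n. H.s 0 (f k - g k) = scaleT (H.qn k) (f k - g k)"
        using f g by (auto simp: PiE_iff mem less_Suc_eq_le H.s_diff tens.scale_right_diff_distrib)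
      show "(\<Sum>k<Suc n. f k - g k) = 0"
        using f g by (simp add: sum_subtractf lessThan_Suc_atMost atLeast0AtMost del: sum.lessThan_Suc)
    qed
    then show "f = g"
      using f g by (intro PiE_ext[of f "{0..n}" _ g]) auto
  qed
  then show ?thesis
    using subspace_tpow subspace_eigenspace by (auto simp: is_direct_sum_def eigenspace_def)
qed

text \<open>The summands are identified with eigenspaces only for \<open>k \<le> n\<close>, so they
  are exchanged on the index set alone.\<close>

lemma is_direct_sum_cong:
  assumes "\<And>k. k \<in> I \<Longrightarrow> E k = F k"
  shows "is_direct_sum W I E \<longleftrightarrow> is_direct_sum W I F"
proof -
  have "PiE I E = PiE I F" using assms by (rule PiE_cong)
  then show ?thesis by (simp only: is_direct_sum_def assms cong: ball_cong)
qed

theorem theorem3p8: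
  fixes m n :: nat
  assumes "m \<ge> 1" and "n \<ge> 1"
  shows "is_direct_sum (tpow m n) {0..n}
           (\<lambda>k. if k = 0 then ker_sigma m n
                else tensor_space (bracket_space m k) (ker_sigma m (n - k)))
       \<and> ker_sigma m n = eigenspace m n 0
       \<and> (\<forall>k\<in>{1..n}. tensor_space (bracket_space m k) (ker_sigma m (n - k))
                       = eigenspace m n (q_int k))"
proof (intro conjI ballI)
  let ?E = "\<lambda>k. if k = 0 then ker_sigma m n
                else tensor_space (bracket_space m k) (ker_sigma m (n - k))"
  have E: "?E k = eigenspace m n (q_int k)" if "k \<in> {0..n}" for k
    using that tensor_space_eq_eigenspace[of k n m]
    \<comment> \<open>\<open>q_int 0\<close> is an empty sum, so the kernel is the summand for
      \<open>k = 0\<close>.\<close>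
    by (cases "k = 0") (simp_all add: ker_sigma_eq_eigenspace q_int_def)
  show "is_direct_sum (tpow m n) {0..n} ?E"
    by (rule iffD2[OF is_direct_sum_cong[OF E] is_direct_sum_eigenspaces])
qed (simp_all only: ker_sigma_eq_eigenspace tensor_space_eq_eigenspace[unfolded ker_sigma_eq_eigenspace]
    atLeastAtMost_iff)

end
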